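(* Let $d,N$ be positive integers, let $0<\tau_1<\cdots<\tau_N$ be real numbers, and let $D_1,\dots,D_N:\mathbb{R}\to\mathbb{C}^{d\times d}$ be continuous. Let $s\in\mathbb{R}$ and let $\phi\in C_s$, i.e. $\phi:[-\tau_N,0]\to\mathbb{C}^d$ is continuous and $\phi(0)=\sum_{j=1}^N D_j(s)\phi(-\tau_j)$. Let $X:\mathbb{R}^2\to\mathbb{C}^{d\times d}$ be the fundamental solution, i.e. the unique map such that $X(t,\alpha)=0$ for $t<\alpha$ and $X(t,\alpha)=I_d+\sum_{j=1}^N D_j(t)X(t-\tau_j,\alpha)$ for $t\ge \alpha$. Then the solution $y\in C^0([s-\tau_N,+\infty),\mathbb{C}^d)$ of $$y(t)=\sum_{j=1}^N D_j(t)\,y(t-\tau_j)\quad (t>s),\qquad y(s+\theta)=\phi(\theta)\quad (-\tau_N\le\theta\le 0),$$ is given by $$y(t)=-\sum_{j=1}^N\int_{s^-}^{(s+\tau_j)^-} d_\alpha X(t,\alpha)\,D_j(\alpha)\,\phi(\alpha-\tau_j-s),\qquad t\ge s,$$ where the $j$-th integral is the Lebesgue-Stieltjes integral over the interval $[s,s+\tau_j)$ with respect to the function $\alpha\mapsto X(t,\alpha)$ (which is locally of bounded variation for each fixed $t$).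
   Context: $C^0(E,F)$ is the set of continuous maps from $E$ to $F$, and $I_d$ is the $d\times d$ identity matrix. For every $\phi\in C_s$ the delay system has a unique solution $y:[s-\tau_N,+\infty)\to\mathbb{C}^d$ with initial data $\phi$, and it is continuous. The fundamental solution $X$ exists and is unique. Lebesgue-Stieltjes convention. For a real interval $I$ and a function $f$ of bounded variation on $I$, $\nu_f$ denotes the finite Borel measure on $I$ such that $\nu_f((x,y))=f(y^-)-f(x^+)$ for open subintervals $(x,y)$ of $I$, and, if $I$ is bounded and contains its left endpoint $a$ (resp. its right endpoint $b$), $\nu_f(\{a\})=f(a^+)-f(a)$ (resp. $\nu_f(\{b\})=f(b)-f(b^-)$); here $f(x^\pm)$ are the one-sided limits. For a subinterval $J$, $\int_J df\,g$ means the integral of $g$ over $J$ against the measure $\nu_{(f|_J)}$ associated with the restriction $f|_J$ (not against the restriction of $\nu_f$ to $J$). The notation $\int_{c^-}^{e^-}$ means integration over $J=[c,e)$. For matrix-valued $f$ the measure is defined entrywise, and $d_\alpha X(t,\alpha)D_j(\alpha)\phi(\cdot)$ is a matrix product in that order, whose entries are sums of ordinary Lebesgue-Stieltjes integrands; $d_\alpha$ means that the differential is taken with respect to $\alpha$, with $t$ fixed. *)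

theory Defs
  imports "HOL-Analysis.Analysis"
begin

text \<open>
  Complex measures on the Borel subsets of \<open>I\<close>. They are set functions that vanish by convention
  on all other sets, so that a measure is determined by its values on Borel subsets of \<open>I\<close>.
\<close>

definition complex_measure_on :: "real set \<Rightarrow> (real set \<Rightarrow> complex) \<Rightarrow> bool" where
  "complex_measure_on I \<nu> \<longleftrightarrow>
     (\<forall>A. range A \<subseteq> sets (restrict_space borel I) \<longrightarrow> disjoint_family A \<longrightarrow>
        (\<lambda>n::nat. \<nu> (A n)) sums \<nu> (\<Union>n. A n)) \<and>
     (\<forall>A. A \<notin> sets (restrict_space borel I) \<longrightarrow> \<nu> A = 0)"

text \<open>
  Positive variation of a finite signed measure \<open>\<rho>\<close> on \<open>I\<close>:
  \<open>\<rho>\<^sup>+ A = sup {\<rho> B | B \<subseteq> A}\<close>. The truncation of negative values by \<open>ennreal\<close>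
  is harmless since \<open>B = {}\<close> is admitted. The negative variation is that of \<open>- \<rho>\<close>.
\<close>

definition positive_variation :: "real set \<Rightarrow> (real set \<Rightarrow> real) \<Rightarrow> real measure" where
  "positive_variation I \<rho> =
     measure_of I (sets (restrict_space borel I))
       (\<lambda>A. SUP B \<in> {B \<in> sets (restrict_space borel I). B \<subseteq> A}. ennreal (\<rho> B))"

definition signed_measure_integral ::
  "real set \<Rightarrow> (real set \<Rightarrow> real) \<Rightarrow> (real \<Rightarrow> complex) \<Rightarrow> complex" where
  "signed_measure_integral I \<rho> g =
     integral\<^sup>L (positive_variation I \<rho>) g - integral\<^sup>L (positive_variation I (\<lambda>A. - \<rho> A)) g"

definition complex_measure_integral ::
  "real set \<Rightarrow> (real set \<Rightarrow> complex) \<Rightarrow> (real \<Rightarrow> complex) \<Rightarrow> complex" where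
  "complex_measure_integral I \<nu> g =
     signed_measure_integral I (\<lambda>A. Re (\<nu> A)) g + \<i> * signed_measure_integral I (\<lambda>A. Im (\<nu> A)) g"

definition bounded_variation_on :: "real set \<Rightarrow> (real \<Rightarrow> 'a::real_normed_vector) \<Rightarrow> bool" where
  "bounded_variation_on I f \<longleftrightarrow>
     (\<exists>M. \<forall>(n::nat) p. (\<forall>i\<le>n. p i \<in> I) \<longrightarrow> (\<forall>i<n. p i \<le> p (Suc i)) \<longrightarrow>
        (\<Sum>i<n. norm (f (p (Suc i)) - f (p i))) \<le> M)"

text \<open>
  For an interval \<open>I\<close> with more than one point and \<open>f\<close> of bounded variation on \<open>I\<close>, the limits below
  exist and are taken from within \<open>I\<close>. Hence only the values of \<open>f\<close> on \<open>I\<close> matter: this is the measure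
  of the restriction of \<open>f\<close> to \<open>I\<close>. In general it differs from the restriction to \<open>I\<close> of the measure of \<open>f\<close>
  on a larger interval, because of the masses at the end points that belong to \<open>I\<close>.
\<close>

definition is_stieltjes_measure ::
  "real set \<Rightarrow> (real \<Rightarrow> complex) \<Rightarrow> (real set \<Rightarrow> complex) \<Rightarrow> bool" where
  "is_stieltjes_measure I f \<nu> \<longleftrightarrow>
     complex_measure_on I \<nu> \<and>
     (\<forall>x y. x < y \<longrightarrow> {x<..<y} \<subseteq> I \<longrightarrow> \<nu> {x<..<y} = Lim (at_left y) f - Lim (at_right x) f) \<and>
     (\<forall>a\<in>I. (\<forall>x\<in>I. a \<le> x) \<longrightarrow> \<nu> {a} = Lim (at_right a) f - f a) \<and>
     (\<forall>b\<in>I. (\<forall>x\<in>I. x \<le> b) \<longrightarrow> \<nu> {b} = f b - Lim (at_left b) f)"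

definition stieltjes_measure :: "real set \<Rightarrow> (real \<Rightarrow> complex) \<Rightarrow> real set \<Rightarrow> complex" where
  "stieltjes_measure I f = (THE \<nu>. is_stieltjes_measure I f \<nu>)"

definition stieltjes_integral ::
  "real set \<Rightarrow> (real \<Rightarrow> complex) \<Rightarrow> (real \<Rightarrow> complex) \<Rightarrow> complex" where
  "stieltjes_integral I f g = complex_measure_integral I (stieltjes_measure I f) g"

definition matrix_stieltjes_integral ::
  "real set \<Rightarrow> (real \<Rightarrow> complex^'n^'m) \<Rightarrow> (real \<Rightarrow> complex^'n) \<Rightarrow> complex^'m" where
  "matrix_stieltjes_integral I F g =
     (\<chi> i. \<Sum>k\<in>UNIV. stieltjes_integral I (\<lambda>\<alpha>. F \<alpha> $ i $ k) (\<lambda>\<alpha>. g \<alpha> $ k))"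

text \<open>
  Delays and coefficients are indexed by \<open>{1..N}\<close>; their values at other indices are irrelevant.
\<close>

definition compatible_initial_data ::
  "nat \<Rightarrow> (nat \<Rightarrow> real) \<Rightarrow> (nat \<Rightarrow> real \<Rightarrow> complex^'d^'d) \<Rightarrow> real \<Rightarrow> (real \<Rightarrow> complex^'d) \<Rightarrow> bool" where
  "compatible_initial_data N \<tau> D s \<phi> \<longleftrightarrow>
     continuous_on {- \<tau> N..0} \<phi> \<and> \<phi> 0 = (\<Sum>j=1..N. D j s *v \<phi> (- \<tau> j))"

definition delay_solution ::
  "nat \<Rightarrow> (nat \<Rightarrow> real) \<Rightarrow> (nat \<Rightarrow> real \<Rightarrow> complex^'d^'d) \<Rightarrow> real \<Rightarrow> (real \<Rightarrow> complex^'d) \<Rightarrow>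
     (real \<Rightarrow> complex^'d) \<Rightarrow> bool" where
  "delay_solution N \<tau> D s \<phi> y \<longleftrightarrow>
     continuous_on {s - \<tau> N..} y \<and>
     (\<forall>t>s. y t = (\<Sum>j=1..N. D j t *v y (t - \<tau> j))) \<and>
     (\<forall>\<theta>\<in>{- \<tau> N..0}. y (s + \<theta>) = \<phi> \<theta>)"

definition fundamental_solution ::
  "nat \<Rightarrow> (nat \<Rightarrow> real) \<Rightarrow> (nat \<Rightarrow> real \<Rightarrow> complex^'d^'d) \<Rightarrow> (real \<Rightarrow> real \<Rightarrow> complex^'d^'d) \<Rightarrow> bool"
  where
  "fundamental_solution N \<tau> D X \<longleftrightarrow>
     (\<forall>t \<alpha>. t < \<alpha> \<longrightarrow> X t \<alpha> = 0) \<and>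
     (\<forall>t \<alpha>. \<alpha> \<le> t \<longrightarrow> X t \<alpha> = mat 1 + (\<Sum>j=1..N. D j t ** X (t - \<tau> j) \<alpha>))"

end

theory Submission
  imports Defs
begin

text \<open>
  The integrals in the representation formula are finite sums in disguise. Unfolding the equation of
  the fundamental solution shows that, on a half-line \<open>[a, \<infinity>)\<close>, the function \<open>\<alpha> \<mapsto> X t \<alpha>\<close> is a finite
  sum \<open>\<Sum>\<^sub>p c\<^sub>p 1(\<alpha> \<le> p)\<close>: the points \<open>p\<close> are the numbers \<open>t - \<tau>\<^sub>i - \<tau>\<^sub>j - \<dots>\<close> that are still at least \<open>a\<close>, and
  \<open>c\<^sub>p\<close> adds up the products of coefficients \<open>D\<^sub>i(t) D\<^sub>j(t - \<tau>\<^sub>i) \<dots>\<close> along the ways of reaching \<open>p\<close>. Such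
  a function has bounded variation. It is left-continuous and drops by \<open>c\<^sub>p\<close> immediately to the right
  of \<open>p\<close>; hence its Stieltjes measure on any \<open>[a, b)\<close> is \<open>- \<Sum>\<^sub>p c\<^sub>p \<delta>\<^sub>p\<close>, where a jump at the left end point
  is counted in full because that end point belongs to the interval.

  The same points and coefficients solve the inhomogeneous problem. If \<open>z\<close> vanishes before \<open>a\<close> and
  \<open>z(t) = h(t) + \<Sum>\<^sub>j D\<^sub>j(t) z(t - \<tau>\<^sub>j)\<close> from \<open>a\<close> on, then the same unfolding gives \<open>z(t) = \<Sum>\<^sub>p c\<^sub>p h(p)\<close>.
  This discrete variation of constants formula, \<open>variation_of_constants\<close>, is proved
  by recursion along steps no longer than the smallest delay, for \<open>X\<close> and \<open>z\<close> simultaneously.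

  The solution \<open>y\<close>, cut off before \<open>s\<close>, is such a \<open>z\<close>. The terms \<open>D\<^sub>j(t) y(t - \<tau>\<^sub>j)\<close> with
  \<open>t - \<tau>\<^sub>j < s\<close> only see the initial data, and together they form the forcing
  \<open>h(p) = \<Sum>\<^sub>j 1(s \<le> p < s + \<tau>\<^sub>j) D\<^sub>j(p) \<phi>(p - \<tau>\<^sub>j - s)\<close>. The windows \<open>[s, s + \<tau>\<^sub>j)\<close> in \<open>h\<close> are the
  domains of integration, so \<open>\<Sum>\<^sub>p c\<^sub>p h(p)\<close> is minus the sum of the Stieltjes integrals, by
  \<open>matrix_stieltjes_integral_left_step\<close>.
\<close>

section \<open>Left-continuous step functions\<close>

definition left_step :: "real set \<Rightarrow> (real \<Rightarrow> 'a::comm_monoid_add) \<Rightarrow> real \<Rightarrow> 'a" where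
  "left_step T c \<alpha> = (\<Sum>p | p \<in> T \<and> \<alpha> \<le> p. c p)"

lemma left_step_if: "finite T \<Longrightarrow> left_step T c \<alpha> = (\<Sum>p\<in>T. if \<alpha> \<le> p then c p else 0)"
  unfolding left_step_def by (simp add: sum.inter_filter)

lemma left_step_diff:
  fixes c :: "real \<Rightarrow> 'a::ab_group_add"
  assumes "finite T" "x \<le> y"
  shows "left_step T c x - left_step T c y = (\<Sum>p | p \<in> T \<and> x \<le> p \<and> p < y. c p)"
proof -
  have "{p \<in> T. x \<le> p} = {p \<in> T. x \<le> p \<and> p < y} \<union> {p \<in> T. y \<le> p}"
    using assms(2) by auto
  moreover have "{p \<in> T. x \<le> p \<and> p < y} \<inter> {p \<in> T. y \<le> p} = {}" by auto
  ultimately show ?thesis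
    unfolding left_step_def using assms(1) by (simp add: sum.union_disjoint)
qed

text \<open>
  The increments of a step function are dominated by the decrements of the step function with the
  coefficients replaced by their norms. The latter decreases, so its decrements telescope.
\<close>

lemma left_step_bounded_variation_on:
  fixes f :: "real \<Rightarrow> 'a::real_normed_vector"
  assumes T: "finite T" and f: "\<And>\<alpha>. \<alpha> \<in> I \<Longrightarrow> f \<alpha> = left_step T c \<alpha>"
  shows "bounded_variation_on I f"
  unfolding bounded_variation_on_def
proof (intro exI allI impI)
  fix n :: nat and p :: "nat \<Rightarrow> real"
  assume p: "\<forall>i\<le>n. p i \<in> I" "\<forall>i<n. p i \<le> p (Suc i)"
  define V where "V = left_step T (\<lambda>q. norm (c q))"
  have "norm (f (p (Suc i)) - f (p i)) \<le> V (p i) - V (p (Suc i))" if "i < n" for i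
  proof -
    have "norm (f (p (Suc i)) - f (p i)) = norm (left_step T c (p i) - left_step T c (p (Suc i)))"
      using p(1) that f by (simp add: norm_minus_commute)
    also have "\<dots> \<le> V (p i) - V (p (Suc i))"
      unfolding V_def using p(2) that T by (simp add: left_step_diff norm_sum)
    finally show ?thesis .
  qed
  then have "(\<Sum>i<n. norm (f (p (Suc i)) - f (p i))) \<le> (\<Sum>i<n. V (p i) - V (p (Suc i)))"
    by (intro sum_mono) simp
  also have "\<dots> = V (p 0) - V (p n)" using sum_lessThan_telescope'[of "\<lambda>i. V (p i)" n] by simp
  also have "\<dots> \<le> (\<Sum>q\<in>T. norm (c q))"
  proof -
    have "V (p 0) \<le> (\<Sum>q\<in>T. norm (c q))"
      unfolding V_def left_step_def using T by (intro sum_mono2) auto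
    moreover have "0 \<le> V (p n)"
      unfolding V_def left_step_def by (simp add: sum_nonneg)
    ultimately show ?thesis by simp
  qed
  finally show "(\<Sum>i<n. norm (f (p (Suc i)) - f (p i))) \<le> (\<Sum>q\<in>T. norm (c q))" .
qed

lemma left_step_tendsto_left:
  fixes c :: "real \<Rightarrow> 'a::topological_comm_monoid_add"
  assumes "finite T"
  shows "(left_step T c \<longlongrightarrow> left_step T c y) (at_left y)"
proof -
  have "((\<lambda>\<alpha>. if \<alpha> \<le> p then c p else 0) \<longlongrightarrow> (if y \<le> p then c p else 0)) (at_left y)" for p
  proof (rule tendsto_eventually, cases "y \<le> p")
    case True
    then show "\<forall>\<^sub>F \<alpha> in at_left y. (if \<alpha> \<le> p then c p else 0) = (if y \<le> p then c p else 0)"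
      by (auto simp: eventually_at_filter)
  next
    case False
    then have "\<forall>\<^sub>F \<alpha> in at_left y. \<alpha> \<in> {p<..<y}"
      by (intro eventually_at_leftI[of p]) auto
    then show "\<forall>\<^sub>F \<alpha> in at_left y. (if \<alpha> \<le> p then c p else 0) = (if y \<le> p then c p else 0)"
      by eventually_elim (use False in auto)
  qed
  then show ?thesis
    unfolding left_step_if[OF assms] by (intro tendsto_sum)
qed

lemma left_step_tendsto_right:
  fixes c :: "real \<Rightarrow> 'a::topological_comm_monoid_add"
  assumes "finite T"
  shows "(left_step T c \<longlongrightarrow> (\<Sum>p | p \<in> T \<and> x < p. c p)) (at_right x)"
proof -
  have "((\<lambda>\<alpha>. if \<alpha> \<le> p then c p else 0) \<longlongrightarrow> (if x < p then c p else 0)) (at_right x)" for p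
  proof (rule tendsto_eventually, cases "x < p")
    case False
    then show "\<forall>\<^sub>F \<alpha> in at_right x. (if \<alpha> \<le> p then c p else 0) = (if x < p then c p else 0)"
      by (auto simp: eventually_at_filter)
  next
    case True
    then have "\<forall>\<^sub>F \<alpha> in at_right x. \<alpha> \<in> {x<..<p}"
      by (intro eventually_at_rightI[of _ p]) auto
    then show "\<forall>\<^sub>F \<alpha> in at_right x. (if \<alpha> \<le> p then c p else 0) = (if x < p then c p else 0)"
      by eventually_elim (use True in auto)
  qed
  then show ?thesis
    unfolding left_step_if[OF assms] sum.inter_filter[OF assms] by (intro tendsto_sum)
qed

section \<open>Stieltjes measures on half-open intervals\<close>

lemma complex_measure_on_empty:
  assumes "complex_measure_on I \<nu>"
  shows "\<nu> {} = 0"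
proof -
  have "range (\<lambda>n::nat. {}) \<subseteq> sets (restrict_space borel I)"
    "disjoint_family (\<lambda>n::nat. {} :: real set)"
    by (auto simp: disjoint_family_on_def)
  then have "(\<lambda>n::nat. \<nu> {}) sums \<nu> (\<Union>n::nat. {})"
    using assms unfolding complex_measure_on_def by blast
  then show ?thesis
    by (auto dest: sums_summable simp: summable_const_iff)
qed

lemma complex_measure_on_Un:
  assumes "complex_measure_on I \<nu>" "A \<in> sets (restrict_space borel I)"
    "B \<in> sets (restrict_space borel I)" "A \<inter> B = {}"
  shows "\<nu> (A \<union> B) = \<nu> A + \<nu> B"
proof -
  have "range (binaryset A B) \<subseteq> sets (restrict_space borel I)" "disjoint_family (binaryset A B)"
    using assms(2-4) by (auto simp: range_binaryset_eq disjoint_family_on_def binaryset_def)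
  then have "(\<lambda>n. \<nu> (binaryset A B n)) sums \<nu> (\<Union>n. binaryset A B n)"
    using assms(1) unfolding complex_measure_on_def by blast
  moreover have "(\<lambda>n. \<nu> (binaryset A B n)) sums (\<nu> A + \<nu> B)"
    using complex_measure_on_empty[OF assms(1)] by (rule binaryset_sums)
  ultimately show ?thesis
    unfolding UN_binaryset_eq by (rule sums_unique2)
qed

text \<open>
  The intervals \<open>[a, y)\<close> form a generating family that is closed under intersection. The convention for
  the mass of a left end point determines a Stieltjes measure on exactly these sets.
\<close>

lemma sets_restrict_borel_halfopen:
  fixes a b :: real
  shows "sets (restrict_space borel {a..<b}) = sigma_sets {a..<b} ((\<lambda>y. {a..<y}) ` {..b})"
proof -
  have "sets (restrict_space borel {a..<b}) = sigma_sets {a..<b} ((\<inter>) {a..<b} ` range lessThan)"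
  proof -
    have borel: "sets borel = sigma_sets UNIV (range (lessThan :: real \<Rightarrow> _))"
      unfolding borel_Iio by (rule sets_measure_of) simp
    have "{a..<b} \<in> sigma_sets UNIV (range lessThan)"
      unfolding borel[symmetric] by simp
    from sigma_sets_Int[OF this] show ?thesis
      by (simp add: sets_restrict_space borel)
  qed
  also have "(\<inter>) {a..<b} ` range lessThan = (\<lambda>y. {a..<y}) ` {..b}"
  proof (intro equalityI subsetI)
    fix A assume "A \<in> (\<inter>) {a..<b} ` range lessThan"
    then obtain y where "A = {a..<b} \<inter> {..<y}" by auto
    then have "A = {a..<min b y}" by auto
    then show "A \<in> (\<lambda>y. {a..<y}) ` {..b}" by auto
  next
    fix A assume "A \<in> (\<lambda>y. {a..<y}) ` {..b}"
    then obtain y where "y \<le> b" "A = {a..<y}" by auto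
    then have "A = {a..<b} \<inter> {..<y}" by auto
    then show "A \<in> (\<inter>) {a..<b} ` range lessThan" by auto
  qed
  finally show ?thesis .
qed

lemma is_stieltjes_measure_initial:
  assumes \<nu>: "is_stieltjes_measure {a..<b} f \<nu>" and y: "a < y" "y \<le> b"
  shows "\<nu> {a..<y} = Lim (at_left y) f - f a"
proof -
  have cm: "complex_measure_on {a..<b} \<nu>" using \<nu> by (simp add: is_stieltjes_measure_def)
  have "{a} \<in> sets (restrict_space borel {a..<b})" "{a<..<y} \<in> sets (restrict_space borel {a..<b})"
    using y by (auto simp: sets_restrict_space_iff)
  then have "\<nu> ({a} \<union> {a<..<y}) = \<nu> {a} + \<nu> {a<..<y}"
    by (intro complex_measure_on_Un[OF cm]) auto
  moreover have "{a} \<union> {a<..<y} = {a..<y}" using y by auto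
  moreover have "\<nu> {a} = Lim (at_right a) f - f a"
    using \<nu> y by (auto simp: is_stieltjes_measure_def)
  moreover have "\<nu> {a<..<y} = Lim (at_left y) f - Lim (at_right a) f"
  proof -
    have "{a<..<y} \<subseteq> {a..<b}" using y by auto
    then show ?thesis using \<nu> y unfolding is_stieltjes_measure_def by blast
  qed
  ultimately show ?thesis by simp
qed

text \<open>
  The definite description behind \<open>stieltjes_measure\<close> denotes as soon as some measure has the required
  values; two such measures agree on the sets \<open>[a, y)\<close> and therefore on all Borel sets, by a Dynkin system
  argument. Complements pose no problem as \<open>[a, b)\<close> is itself one of the generating sets.
\<close>

lemma is_stieltjes_measure_unique:
  assumes ab: "a < b" and \<mu>: "is_stieltjes_measure {a..<b} f \<mu>"
    and \<nu>: "is_stieltjes_measure {a..<b} f \<nu>"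
  shows "\<mu> = \<nu>"
proof
  fix A
  let ?I = "{a..<b}" and ?E = "(\<lambda>y. {a..<y}) ` {..b}"
  have cm: "complex_measure_on ?I \<mu>" "complex_measure_on ?I \<nu>"
    using \<mu> \<nu> by (auto simp: is_stieltjes_measure_def)
  have init: "\<mu> {a..<y} = \<nu> {a..<y}" if "y \<le> b" for y
  proof (cases "a < y")
    case True
    then show ?thesis
      using is_stieltjes_measure_initial[OF \<mu> True that] is_stieltjes_measure_initial[OF \<nu> True that] by simp
  next
    case False
    then show ?thesis using cm by (simp add: complex_measure_on_empty)
  qed
  show "\<mu> A = \<nu> A"
  proof (cases "A \<in> sets (restrict_space borel ?I)")
    case False
    then show ?thesis using cm unfolding complex_measure_on_def by metis
  next
    case True
    have stable: "Int_stable ?E"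
    proof (rule Int_stableI_image)
      fix i j :: real assume "i \<in> {..b}" "j \<in> {..b}"
      then show "\<exists>k\<in>{..b}. {a..<i} \<inter> {a..<j} = {a..<k}"
        by (intro bexI[of _ "min i j"]) auto
    qed
    have closed: "?E \<subseteq> Pow ?I" by auto
    show ?thesis
      using stable closed True[unfolded sets_restrict_borel_halfopen]
    proof (induction rule: sigma_sets_induct_disjoint)
      case (basic A)
      then show ?case using init by auto
    next
      case empty
      show ?case using cm by (simp add: complex_measure_on_empty)
    next
      case (compl A)
      then have A: "A \<in> sets (restrict_space borel ?I)"
        by (simp add: sets_restrict_borel_halfopen)
      then have sub: "A \<subseteq> ?I" using sets.sets_into_space by fastforce
      have A': "?I - A \<in> sets (restrict_space borel ?I)"
        using sets.compl_sets[OF A] by simp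
      have "\<rho> (?I - A) = \<rho> ?I - \<rho> A" if "complex_measure_on ?I \<rho>" for \<rho>
        using complex_measure_on_Un[OF that A A'] sub by (simp add: Un_absorb1)
      from this[OF cm(1)] this[OF cm(2)] show ?case using compl.IH init[of b] by simp
    next
      case (union A)
      then have "range A \<subseteq> sets (restrict_space borel ?I)"
        by (simp add: sets_restrict_borel_halfopen)
      then have "(\<lambda>n. \<mu> (A n)) sums \<mu> (\<Union>n. A n)" "(\<lambda>n. \<nu> (A n)) sums \<nu> (\<Union>n. A n)"
        using cm union unfolding complex_measure_on_def by blast+
      then show ?case using union by (auto simp: sums_iff)
    qed
  qed
qed

text \<open>
  The measure \<open>\<Sum>\<^sub>p c\<^sub>p \<delta>\<^sub>p\<close> on \<open>I\<close>. Points of \<open>T\<close> outside \<open>I\<close> are allowed: they belong to no Borel subset of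
  \<open>I\<close> and carry no mass. So a single \<open>T\<close> serves all the windows \<open>[s, s + \<tau>\<^sub>j)\<close>.
\<close>

definition point_masses :: "real set \<Rightarrow> real set \<Rightarrow> (real \<Rightarrow> complex) \<Rightarrow> real set \<Rightarrow> complex" where
  "point_masses I T c A =
     (if A \<in> sets (restrict_space borel I) then \<Sum>p\<in>T. c p * indicator A p else 0)"

lemma complex_measure_on_point_masses: "complex_measure_on I (point_masses I T c)"
proof -
  have "(\<lambda>n. point_masses I T c (A n)) sums point_masses I T c (\<Union>n. A n)"
    if A: "range A \<subseteq> sets (restrict_space borel I)" "disjoint_family A" for A :: "nat \<Rightarrow> real set"
  proof -
    have "(\<lambda>n. indicator (A n) p :: complex) sums indicator (\<Union>n. A n) p" for p
    proof (cases "p \<in> (\<Union>n. A n)")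
      case True
      then obtain m where m: "p \<in> A m" by auto
      then have "p \<in> A n \<longleftrightarrow> n = m" for n
        using A(2) by (auto simp: disjoint_family_on_def)
      then have "(\<lambda>n. indicator (A n) p :: complex) = (\<lambda>n. if n = m then 1 else 0)"
        by (auto simp: indicator_def)
      then show ?thesis using True sums_single[of m "\<lambda>_. 1::complex"] by simp
    next
      case False
      then show ?thesis by (simp add: indicator_def)
    qed
    then have "(\<lambda>n. \<Sum>p\<in>T. c p * indicator (A n) p) sums (\<Sum>p\<in>T. c p * indicator (\<Union>n. A n) p)"
      by (intro sums_sum sums_mult)
    moreover have "A n \<in> sets (restrict_space borel I)" for n using A by auto
    moreover have "(\<Union>n. A n) \<in> sets (restrict_space borel I)" using A by blast
    ultimately show ?thesis by (simp add: point_masses_def)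
  qed
  then show ?thesis by (simp add: complex_measure_on_def point_masses_def)
qed

text \<open>
  Passing from the left limit at \<open>y\<close> to the right limit at \<open>x\<close> compares the points \<open>p \<ge> y\<close> with the points
  \<open>p > x\<close>. The difference consists of the points strictly in between, with a negative sign.
\<close>

lemma is_stieltjes_measure_left_step:
  assumes T: "finite T" and f: "\<And>\<alpha>. a \<le> \<alpha> \<Longrightarrow> f \<alpha> = left_step T c \<alpha>"
  shows "is_stieltjes_measure {a..<b} f (point_masses {a..<b} T (\<lambda>p. - c p))"
proof -
  have left: "Lim (at_left y) f = (\<Sum>p\<in>T. if y \<le> p then c p else 0)" if "a < y" for y
  proof (rule tendsto_Lim)
    have "\<forall>\<^sub>F \<alpha> in at_left y. \<alpha> \<in> {a<..<y}"
      using that by (intro eventually_at_leftI[of a]) auto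
    then have "\<forall>\<^sub>F \<alpha> in at_left y. left_step T c \<alpha> = f \<alpha>"
      by eventually_elim (simp add: f)
    with left_step_tendsto_left[OF T, of c y]
    show "(f \<longlongrightarrow> (\<Sum>p\<in>T. if y \<le> p then c p else 0)) (at_left y)"
      unfolding left_step_if[OF T, symmetric] by (rule Lim_transform_eventually)
  qed simp
  have right: "Lim (at_right x) f = (\<Sum>p\<in>T. if x < p then c p else 0)" if "a \<le> x" for x
  proof (rule tendsto_Lim)
    have "\<forall>\<^sub>F \<alpha> in at_right x. left_step T c \<alpha> = f \<alpha>"
      using that by (auto simp: eventually_at_filter f)
    with left_step_tendsto_right[OF T, of c x]
    show "(f \<longlongrightarrow> (\<Sum>p\<in>T. if x < p then c p else 0)) (at_right x)"
      unfolding sum.inter_filter[OF T] by (rule Lim_transform_eventually)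
  qed simp
  have "point_masses {a..<b} T (\<lambda>p. - c p) {x<..<y} = Lim (at_left y) f - Lim (at_right x) f"
    if xy: "x < y" "{x<..<y} \<subseteq> {a..<b}" for x y
  proof -
    have "a \<le> x" using xy by (simp add: greaterThanLessThan_subseteq_atLeastLessThan_iff)
    moreover have "{x<..<y} \<in> sets (restrict_space borel {a..<b})"
      using xy by (simp add: sets_restrict_space_iff)
    ultimately show ?thesis
      using xy(1) by (auto simp: point_masses_def left right sum_subtractf[symmetric] intro!: sum.cong)
  qed
  moreover have "point_masses {a..<b} T (\<lambda>p. - c p) {a} = Lim (at_right a) f - f a" if "a < b"
  proof -
    have "{a} \<in> sets (restrict_space borel {a..<b})"
      using that by (simp add: sets_restrict_space_iff)
    then show ?thesis
      by (auto simp: point_masses_def f left_step_if[OF T] right sum_subtractf[symmetric] intro!: sum.cong)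
  qed
  \<comment> \<open>The minimum of the interval is \<open>a\<close>; as there is no maximum, the condition on maxima is vacuous.\<close>
  moreover have "x = a" if "x \<in> {a..<b}" "\<forall>z\<in>{a..<b}. x \<le> z" for x
    using that by (auto intro: antisym)
  moreover have "\<exists>z\<in>{a..<b}. x < z" if "x \<in> {a..<b}" for x
    using that dense[of x b] by (auto intro: less_imp_le order.trans)
  ultimately show ?thesis
    unfolding is_stieltjes_measure_def
    using complex_measure_on_point_masses by (smt (verit) atLeastLessThan_iff)
qed

section \<open>Integration against point masses\<close>

text \<open>
  The supremum over subsets of \<open>A\<close> is attained at the finite set of points of \<open>A\<close> with nonnegative mass.
  Negative masses disappear on the right-hand side because \<open>ennreal\<close> maps them to zero.
\<close>

lemma positive_variation_point_masses:
  fixes r :: "real \<Rightarrow> real"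
  assumes T: "finite T" "T \<subseteq> I"
    and \<rho>: "\<And>A. A \<in> sets (restrict_space borel I) \<Longrightarrow> \<rho> A = (\<Sum>p\<in>T. r p * indicator A p)"
  shows "positive_variation I \<rho> =
    distr (point_measure T (\<lambda>p. ennreal (r p))) (restrict_space borel I) (\<lambda>p. p)"
    (is "_ = ?M")
proof -
  let ?S = "sets (restrict_space borel I)"
  have id: "(\<lambda>p. p) \<in> point_measure T (\<lambda>p. ennreal (r p)) \<rightarrow>\<^sub>M restrict_space borel I"
    using T by (auto simp: measurable_def space_point_measure sets_point_measure space_restrict_space)
  have M: "emeasure ?M A = (\<Sum>p\<in>T \<inter> A. ennreal (r p))" if "A \<in> ?S" for A
  proof -
    have "emeasure ?M A = emeasure (point_measure T (\<lambda>p. ennreal (r p))) (T \<inter> A)"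
      using that by (simp add: emeasure_distr[OF id] space_point_measure Int_commute)
    then show ?thesis using T by (simp add: emeasure_point_measure_finite)
  qed
  have "(SUP B\<in>{B \<in> ?S. B \<subseteq> A}. ennreal (\<rho> B)) = emeasure ?M A" if A: "A \<in> ?S" for A
  proof (rule antisym)
    show "(SUP B\<in>{B \<in> ?S. B \<subseteq> A}. ennreal (\<rho> B)) \<le> emeasure ?M A"
    proof (rule SUP_least)
      fix B assume B: "B \<in> {B \<in> ?S. B \<subseteq> A}"
      have "\<rho> B = (\<Sum>p\<in>T \<inter> B. r p)"
        using B T by (simp add: \<rho> sum.inter_restrict indicator_def if_distrib cong: if_cong)
      also have "\<dots> \<le> (\<Sum>p\<in>T \<inter> B. max 0 (r p))" by (intro sum_mono) simp
      finally have "ennreal (\<rho> B) \<le> ennreal (\<Sum>p\<in>T \<inter> B. max 0 (r p))" by (rule ennreal_leI)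
      also have "\<dots> = (\<Sum>p\<in>T \<inter> B. ennreal (r p))"
      proof -
        have "ennreal (max 0 x) = ennreal x" for x by (simp add: max_def ennreal_neg)
        then show ?thesis by (subst sum_ennreal[symmetric]) simp_all
      qed
      also have "\<dots> \<le> (\<Sum>p\<in>T \<inter> A. ennreal (r p))"
        using B T by (intro sum_mono2) auto
      finally show "ennreal (\<rho> B) \<le> emeasure ?M A" using M[OF A] by simp
    qed
  next
    define B where "B = {p \<in> T \<inter> A. 0 \<le> r p}" \<comment> \<open>the maximiser, up to points of mass zero\<close>
    have fin: "finite B" "B \<subseteq> T \<inter> A" using T by (auto simp: B_def)
    have sub: "A \<subseteq> I" using sets.sets_into_space[OF A] by (simp add: space_restrict_space)
    have "B \<in> sets borel" using fin by (simp add: finite_imp_closed borel_closed)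
    then have B: "B \<in> ?S" using fin sub by (auto simp: sets_restrict_space)
    have "emeasure ?M A = (\<Sum>p\<in>B. ennreal (r p))"
      unfolding M[OF A] using T by (intro sum.mono_neutral_right) (auto simp: B_def ennreal_eq_0_iff)
    also have "\<dots> = ennreal (\<Sum>p\<in>B. r p)"
      by (intro sum_ennreal) (simp add: B_def)
    also have "(\<Sum>p\<in>B. r p) = \<rho> B"
      using B T fin by (simp add: \<rho> indicator_def if_distrib sum.inter_restrict[symmetric] Int_absorb1 cong: if_cong)
    also have "ennreal (\<rho> B) \<le> (SUP B\<in>{B \<in> ?S. B \<subseteq> A}. ennreal (\<rho> B))"
      using B fin by (intro SUP_upper) auto
    finally show "emeasure ?M A \<le> (SUP B\<in>{B \<in> ?S. B \<subseteq> A}. ennreal (\<rho> B))" .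
  qed
  then have "positive_variation I \<rho> = measure_of I ?S (emeasure ?M)"
    unfolding positive_variation_def
    by (intro measure_of_eq) (use sets.space_closed[of "restrict_space borel I"]
        sets.sigma_sets_eq[of "restrict_space borel I"] in \<open>auto simp: space_restrict_space\<close>)
  also have "\<dots> = ?M"
    using measure_of_of_measure[of ?M] by (simp add: space_restrict_space)
  finally show ?thesis .
qed

lemma signed_measure_integral_point_masses:
  fixes r :: "real \<Rightarrow> real"
  assumes T: "finite T" "T \<subseteq> I" and g: "g \<in> borel_measurable (restrict_space borel I)"
    and \<rho>: "\<And>A. A \<in> sets (restrict_space borel I) \<Longrightarrow> \<rho> A = (\<Sum>p\<in>T. r p * indicator A p)"
  shows "signed_measure_integral I \<rho> g = (\<Sum>p\<in>T. of_real (r p) * g p)"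
proof -
  have pos: "integral\<^sup>L (positive_variation I \<rho>) g = (\<Sum>p\<in>T. of_real (max 0 (r p)) * g p)"
    if \<rho>: "\<And>A. A \<in> sets (restrict_space borel I) \<Longrightarrow> \<rho> A = (\<Sum>p\<in>T. r p * indicator A p)"
    for \<rho> r
  proof -
    have "(\<lambda>p. p) \<in> point_measure T (\<lambda>p. ennreal (r p)) \<rightarrow>\<^sub>M restrict_space borel I"
      using T by (auto simp: measurable_def space_point_measure sets_point_measure space_restrict_space)
    then have "integral\<^sup>L (positive_variation I \<rho>) g = integral\<^sup>L (point_measure T (\<lambda>p. ennreal (r p))) g"
      by (simp add: positive_variation_point_masses[OF T \<rho>] integral_distr[OF _ g])
    also have "(\<lambda>p. ennreal (r p)) = (\<lambda>p. ennreal (max 0 (r p)))"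
      by (auto simp: max_def ennreal_neg)
    finally show ?thesis
      using T by (simp add: lebesgue_integral_point_measure_finite scaleR_conv_of_real)
  qed
  have "- \<rho> A = (\<Sum>p\<in>T. - r p * indicator A p)" if "A \<in> sets (restrict_space borel I)" for A
    using \<rho>[OF that] by (simp add: sum_negf)
  from pos[OF this] pos[OF \<rho>] show ?thesis
    unfolding signed_measure_integral_def
    by (auto simp: sum_subtractf[symmetric] left_diff_distrib[symmetric] max_def intro!: sum.cong)
qed

lemma complex_measure_integral_point_masses:
  assumes T: "finite T" and g: "g \<in> borel_measurable (restrict_space borel I)"
  shows "complex_measure_integral I (point_masses I T c) g = (\<Sum>p\<in>T \<inter> I. c p * g p)"
proof -
  have mass: "point_masses I T c A = (\<Sum>p\<in>T \<inter> I. c p * indicator A p)"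
    if A: "A \<in> sets (restrict_space borel I)" for A
  proof -
    have "A \<subseteq> I" using sets.sets_into_space[OF A] by (simp add: space_restrict_space)
    then have "(\<Sum>p\<in>T. c p * indicator A p) = (\<Sum>p\<in>T \<inter> I. c p * indicator A p)"
      using T by (intro sum.mono_neutral_right) (auto simp: indicator_def)
    then show ?thesis using A by (simp add: point_masses_def)
  qed
  have re: "Re (point_masses I T c A) = (\<Sum>p\<in>T \<inter> I. Re (c p) * indicator A p)"
    and im: "Im (point_masses I T c A) = (\<Sum>p\<in>T \<inter> I. Im (c p) * indicator A p)"
    if "A \<in> sets (restrict_space borel I)" for A
    by (auto simp: mass[OF that] indicator_def intro!: sum.cong)
  have fin: "finite (T \<inter> I)" "T \<inter> I \<subseteq> I" using T by auto
  have "signed_measure_integral I (\<lambda>A. Re (point_masses I T c A)) g = (\<Sum>p\<in>T \<inter> I. of_real (Re (c p)) * g p)"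
    "signed_measure_integral I (\<lambda>A. Im (point_masses I T c A)) g = (\<Sum>p\<in>T \<inter> I. of_real (Im (c p)) * g p)"
    by (rule signed_measure_integral_point_masses[OF fin g], erule re,
        rule signed_measure_integral_point_masses[OF fin g], erule im)
  then have "complex_measure_integral I (point_masses I T c) g =
      (\<Sum>p\<in>T \<inter> I. (of_real (Re (c p)) + \<i> * of_real (Im (c p))) * g p)"
    by (simp add: complex_measure_integral_def sum_distrib_left sum.distrib algebra_simps)
  then show ?thesis by (simp only: complex_eq[symmetric])
qed

text \<open>
  Uniqueness identifies the Stieltjes measure with point masses \<open>- c p\<close>, and integration against these is
  evaluation; continuity makes \<open>g\<close> Borel measurable on the interval.
\<close>

lemma stieltjes_integral_left_step:
  assumes "a < b" and T: "finite T" and f: "\<And>\<alpha>. a \<le> \<alpha> \<Longrightarrow> f \<alpha> = left_step T c \<alpha>"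
    and g: "continuous_on {a..<b} g"
  shows "stieltjes_integral {a..<b} f g = - (\<Sum>p\<in>T \<inter> {a..<b}. c p * g p)"
proof -
  have "is_stieltjes_measure {a..<b} f (point_masses {a..<b} T (\<lambda>p. - c p))"
    using is_stieltjes_measure_left_step[OF T f] .
  then have "stieltjes_measure {a..<b} f = point_masses {a..<b} T (\<lambda>p. - c p)"
    unfolding stieltjes_measure_def
    using is_stieltjes_measure_unique[OF \<open>a < b\<close>] by (intro the_equality) blast+
  then show ?thesis
    unfolding stieltjes_integral_def
    using complex_measure_integral_point_masses[OF T borel_measurable_continuous_on_restrict[OF g]]
    by (simp add: sum_negf)
qed

lemma matrix_stieltjes_integral_left_step:
  fixes F :: "real \<Rightarrow> complex^'n^'m"
  assumes "a < b" and T: "finite T" and F: "\<And>\<alpha>. a \<le> \<alpha> \<Longrightarrow> F \<alpha> = left_step T c \<alpha>"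
    and g: "continuous_on {a..<b} g"
  shows "matrix_stieltjes_integral {a..<b} F g = - (\<Sum>p\<in>T \<inter> {a..<b}. c p *v g p)"
proof -
  have "stieltjes_integral {a..<b} (\<lambda>\<alpha>. F \<alpha> $ i $ k) (\<lambda>\<alpha>. g \<alpha> $ k) =
      - (\<Sum>p\<in>T \<inter> {a..<b}. c p $ i $ k * g p $ k)" for i k
    using assms(1) T
    by (rule stieltjes_integral_left_step)
       (use g in \<open>auto simp: F left_step_def intro!: continuous_intros\<close>)
  then show ?thesis
    unfolding matrix_stieltjes_integral_def
    by (simp add: vec_eq_iff matrix_vector_mult_def sum_negf sum.swap[of _ "T \<inter> {a..<b}"])
qed

section \<open>Variation of constants\<close>

lemma matrix_mult_sum_right: "A ** (\<Sum>x\<in>S. f x) = (\<Sum>x\<in>S. A ** f x)"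
  for A :: "'a::semiring_1^'n^'m"
  using sum_comp_morphism[of "\<lambda>B. A ** B" f S] by (simp add: matrix_add_ldistrib o_def)

lemma matrix_vector_mult_sum_left: "(\<Sum>x\<in>S. f x) *v v = (\<Sum>x\<in>S. f x *v v)"
  for v :: "'a::semiring_1^'n"
  using sum_comp_morphism[of "\<lambda>B. B *v v" f S] by (simp add: matrix_vector_mult_add_rdistrib o_def)

lemma matrix_vector_mult_sum_right: "A *v (\<Sum>x\<in>S. f x) = (\<Sum>x\<in>S. A *v f x)"
  for A :: "'a::semiring_1^'n^'m"
  using sum_comp_morphism[of "\<lambda>v. A *v v" f S] by (simp add: matrix_vector_right_distrib o_def)

text \<open>
  The point is that \<open>T\<close> and \<open>c\<close> serve \<open>X\<close> and \<open>z\<close> at the same time, so that values of \<open>z\<close> are expressed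
  through the jumps of \<open>X\<close>. The induction is over \<open>n\<close> with \<open>t < a + n * \<delta>\<close>: all values at \<open>t - \<tau>\<^sub>j\<close> belong to
  an earlier step. The identity matrix and the forcing \<open>h t\<close> contribute a new jump at \<open>t\<close>, and the jumps of
  \<open>X (t - \<tau>\<^sub>j)\<close> are inherited, multiplied by \<open>D j t\<close>.
\<close>

lemma variation_of_constants:
  fixes X :: "real \<Rightarrow> real \<Rightarrow> complex^'d^'d" and z h :: "real \<Rightarrow> complex^'d"
  assumes X: "fundamental_solution N \<tau> D X"
    and \<delta>: "0 < \<delta>" "\<And>j. j \<in> {1..N} \<Longrightarrow> \<delta> \<le> \<tau> j"
    and z0: "\<And>t. t < a \<Longrightarrow> z t = 0"
    and z: "\<And>t. a \<le> t \<Longrightarrow> z t = h t + (\<Sum>j=1..N. D j t *v z (t - \<tau> j))"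
  obtains T c where "finite T" "\<And>\<alpha>. a \<le> \<alpha> \<Longrightarrow> X t \<alpha> = left_step T c \<alpha>"
    "z t = (\<Sum>p\<in>T. c p *v h p)"
proof -
  have Xlt: "X t \<alpha> = 0" if "t < \<alpha>" for t \<alpha>
    using X that unfolding fundamental_solution_def by blast
  have Xge: "X t \<alpha> = mat 1 + (\<Sum>j=1..N. D j t ** X (t - \<tau> j) \<alpha>)" if "\<alpha> \<le> t" for t \<alpha>
    using X that unfolding fundamental_solution_def by blast
  define R where "R t T c \<longleftrightarrow> finite T \<and> (\<forall>\<alpha>\<ge>a. X t \<alpha> = left_step T c \<alpha>) \<and>
    z t = (\<Sum>p\<in>T. c p *v h p)" for t T c
  have before: "R t {} (\<lambda>_. 0)" if "t < a" for t
    using that Xlt z0 by (simp add: R_def left_step_def)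
  have "\<exists>T c. R t T c" if "t < a + real n * \<delta>" for n t
    using that
  proof (induction n arbitrary: t)
    case 0
    then show ?case using before by auto
  next
    case (Suc n)
    show ?case
    proof (cases "t < a")
      case True
      then show ?thesis using before by blast
    next
      case False
      have "\<exists>T c. R (t - \<tau> j) T c" if "j \<in> {1..N}" for j
        using Suc.prems \<delta>(2)[OF that] by (intro Suc.IH) (simp add: algebra_simps)
      then obtain T' c' where R': "\<And>j. j \<in> {1..N} \<Longrightarrow> R (t - \<tau> j) (T' j) (c' j)"
        by metis
      \<comment> \<open>The sets \<open>T' j\<close> may overlap and \<open>c' j\<close> is arbitrary outside \<open>T' j\<close>, so \<open>c' j\<close> is cut off there.\<close>
      define T where "T = insert t (\<Union>j\<in>{1..N}. T' j)"
      define c where "c p = (if p = t then mat 1 else 0) +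
        (\<Sum>j=1..N. D j t ** (if p \<in> T' j then c' j p else 0))" for p
      have fin: "finite T" "\<And>j. j \<in> {1..N} \<Longrightarrow> finite (T' j)"
        using R' by (auto simp: T_def R_def)
      have sub: "T' j \<subseteq> T" if "j \<in> {1..N}" for j using that by (auto simp: T_def)
      have step: "left_step T c \<alpha> = (if \<alpha> \<le> t then mat 1 else 0) +
          (\<Sum>j=1..N. D j t ** left_step (T' j) (c' j) \<alpha>)" for \<alpha>
      proof -
        have atoms: "(\<Sum>p | p \<in> T \<and> \<alpha> \<le> p. if p \<in> T' j then c' j p else 0) = left_step (T' j) (c' j) \<alpha>"
          if "j \<in> {1..N}" for j
          unfolding left_step_def using fin(1) sub[OF that]
          by (intro sum.mono_neutral_cong_right) auto
        have "(\<Sum>p | p \<in> T \<and> \<alpha> \<le> p. \<Sum>j=1..N. D j t ** (if p \<in> T' j then c' j p else 0)) =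
            (\<Sum>j=1..N. D j t ** left_step (T' j) (c' j) \<alpha>)"
          by (subst sum.swap) (simp add: matrix_mult_sum_right[symmetric] atoms)
        moreover have "(\<Sum>p | p \<in> T \<and> \<alpha> \<le> p. if p = t then mat 1 else 0) =
            (if \<alpha> \<le> t then mat 1 else (0 :: complex^'d^'d))"
          using fin(1) by (subst sum.delta) (auto simp: T_def)
        ultimately show ?thesis
          unfolding left_step_def[of T] c_def by (simp add: sum.distrib)
      qed
      have "X t \<alpha> = left_step T c \<alpha>" if "a \<le> \<alpha>" for \<alpha>
      proof -
        have *: "left_step (T' j) (c' j) \<alpha> = X (t - \<tau> j) \<alpha>" if "j \<in> {1..N}" for j
          using R'[OF that] \<open>a \<le> \<alpha>\<close> by (simp add: R_def)
        show ?thesis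
        proof (cases "\<alpha> \<le> t")
          case True
          then show ?thesis by (simp add: step * Xge[OF True])
        next
          \<comment> \<open>To the right of \<open>t\<close> the step function must vanish; no inherited jump lies there.\<close>
          case False
          then have "X (t - \<tau> j) \<alpha> = 0" if "j \<in> {1..N}" for j
            using \<delta>(1) \<delta>(2)[OF that] by (intro Xlt) simp
          then show ?thesis using False by (simp add: step * Xlt)
        qed
      qed
      moreover have "z t = (\<Sum>p\<in>T. c p *v h p)"
      proof -
        have atoms: "(\<Sum>p\<in>T. (D j t ** (if p \<in> T' j then c' j p else 0)) *v h p) = D j t *v z (t - \<tau> j)"
          if j: "j \<in> {1..N}" for j
        proof -
          have "(\<Sum>p\<in>T. (D j t ** (if p \<in> T' j then c' j p else 0)) *v h p) =
              D j t *v (\<Sum>p\<in>T. (if p \<in> T' j then c' j p else 0) *v h p)"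
            by (simp add: matrix_vector_mult_sum_right matrix_vector_mul_assoc)
          also have "(\<Sum>p\<in>T. (if p \<in> T' j then c' j p else 0) *v h p) = z (t - \<tau> j)"
            using R'[OF j] fin(1) sub[OF j]
            by (simp add: R_def) (intro sum.mono_neutral_cong_right, auto)
          finally show ?thesis .
        qed
        have "(\<Sum>p\<in>T. \<Sum>j=1..N. (D j t ** (if p \<in> T' j then c' j p else 0)) *v h p) =
            (\<Sum>j=1..N. D j t *v z (t - \<tau> j))"
          by (subst sum.swap) (simp only: atoms cong: sum.cong)
        moreover have "(\<Sum>p\<in>T. (if p = t then mat 1 else 0) *v h p) = h t"
        proof -
          have "(\<Sum>p\<in>T. (if p = t then mat 1 else 0) *v h p) = (\<Sum>p\<in>T. if p = t then h p else 0)"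
            by (intro sum.cong) auto
          then show ?thesis using fin(1) by (simp add: T_def)
        qed
        ultimately show ?thesis
          unfolding c_def using z[of t] False
          by (simp only: matrix_vector_mult_add_rdistrib matrix_vector_mult_sum_left sum.distrib not_less)
      qed
      ultimately show ?thesis using fin(1) unfolding R_def by blast
    qed
  qed
  moreover obtain n where "(t - a) / \<delta> < real n" using reals_Archimedean2 by blast
  then have "t < a + real n * \<delta>" using \<delta>(1) by (simp add: field_simps)
  ultimately show ?thesis using that unfolding R_def by blast
qed

theorem theorem1:
  fixes N :: nat and \<tau> :: "nat \<Rightarrow> real" and D :: "nat \<Rightarrow> real \<Rightarrow> complex^'d^'d"
    and s :: real and \<phi> y :: "real \<Rightarrow> complex^'d"
    and X :: "real \<Rightarrow> real \<Rightarrow> complex^'d^'d"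
  assumes "N \<ge> 1"
    and "0 < \<tau> 1" and "strict_mono_on {1..N} \<tau>"
    and "\<And>j. j \<in> {1..N} \<Longrightarrow> continuous_on UNIV (D j)"
    and "compatible_initial_data N \<tau> D s \<phi>"
    and "fundamental_solution N \<tau> D X"
    and "delay_solution N \<tau> D s \<phi> y"
  shows "(\<forall>t a b. bounded_variation_on {a..b} (\<lambda>\<alpha>. X t \<alpha>)) \<and>
    (\<forall>t\<ge>s. y t =
      - (\<Sum>j=1..N. matrix_stieltjes_integral {s..<s + \<tau> j} (\<lambda>\<alpha>. X t \<alpha>)
           (\<lambda>\<alpha>. D j \<alpha> *v \<phi> (\<alpha> - \<tau> j - s))))"
proof (intro conjI allI impI)
  have \<tau>: "\<tau> 1 \<le> \<tau> j" "\<tau> j \<le> \<tau> N" "0 < \<tau> j" if "j \<in> {1..N}" for j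
  proof -
    show "\<tau> 1 \<le> \<tau> j" "\<tau> j \<le> \<tau> N"
      using that assms(1) strict_mono_on_leD[OF assms(3)] by auto
    then show "0 < \<tau> j" using assms(2) by simp
  qed
  show "bounded_variation_on {a..b} (\<lambda>\<alpha>. X t \<alpha>)" for t a b
  proof -
    \<comment> \<open>Zero forcing: only the description of \<open>X\<close> is of interest.\<close>
    obtain T c where "finite T" "\<And>\<alpha>. a \<le> \<alpha> \<Longrightarrow> X t \<alpha> = left_step T c \<alpha>"
      by (rule variation_of_constants[OF assms(6,2) \<tau>(1), of a "\<lambda>_. 0" "\<lambda>_. 0" t]) auto
    then show ?thesis by (intro left_step_bounded_variation_on) auto
  qed
  fix t assume t: "s \<le> t"
  define h where "h p = (\<Sum>j=1..N. if p \<in> {s..<s + \<tau> j} then D j p *v \<phi> (p - \<tau> j - s) else 0)" for p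
  define z where "z p = (if p < s then 0 else y p)" for p
  have hist: "y p = \<phi> (p - s)" if "s - \<tau> N \<le> p" "p \<le> s" for p
  proof -
    have "y (s + (p - s)) = \<phi> (p - s)"
      using that assms(7) unfolding delay_solution_def by (metis (no_types, opaque_lifting)
          atLeastAtMost_iff diff_le_eq le_diff_eq add.commute add_0 diff_conv_add_uminus)
    then show ?thesis by simp
  qed
  \<comment> \<open>The compatibility condition on the initial data extends the delay equation to \<open>p = s\<close>.\<close>
  have eq: "y p = (\<Sum>j=1..N. D j p *v y (p - \<tau> j))" if "s \<le> p" for p
  proof (cases "p = s")
    case True
    have "y (s - \<tau> j) = \<phi> (- \<tau> j)" if "j \<in> {1..N}" for j
      using \<tau>[OF that] hist[of "s - \<tau> j"] by simp
    moreover have "y s = \<phi> 0"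
      using \<tau>[of N] assms(1) hist[of s] by simp
    ultimately show ?thesis
      using True assms(5) by (simp add: compatible_initial_data_def)
  next
    case False
    then show ?thesis using that assms(7) unfolding delay_solution_def by auto
  qed
  have "z p = h p + (\<Sum>j=1..N. D j p *v z (p - \<tau> j))" if p: "s \<le> p" for p
  proof -
    have "D j p *v y (p - \<tau> j) = (if p \<in> {s..<s + \<tau> j} then D j p *v \<phi> (p - \<tau> j - s) else 0) +
        D j p *v z (p - \<tau> j)" if j: "j \<in> {1..N}" for j
      using \<tau>[OF j] p by (auto simp: z_def hist)
    then show ?thesis
      using p by (simp add: z_def[of p] eq[OF p] h_def sum.distrib)
  qed
  then obtain T c where T: "finite T" and X: "\<And>\<alpha>. s \<le> \<alpha> \<Longrightarrow> X t \<alpha> = left_step T c \<alpha>"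
    and zt: "z t = (\<Sum>p\<in>T. c p *v h p)"
    using variation_of_constants[OF assms(6,2) \<tau>(1), of s z h t] by (auto simp: z_def)
  have "matrix_stieltjes_integral {s..<s + \<tau> j} (\<lambda>\<alpha>. X t \<alpha>) (\<lambda>\<alpha>. D j \<alpha> *v \<phi> (\<alpha> - \<tau> j - s)) =
      - (\<Sum>p\<in>T \<inter> {s..<s + \<tau> j}. c p *v (D j p *v \<phi> (p - \<tau> j - s)))" if j: "j \<in> {1..N}" for j
  proof (rule matrix_stieltjes_integral_left_step[OF _ T X])
    have "continuous_on {s..<s + \<tau> j} (\<lambda>\<alpha>. \<phi> (\<alpha> - \<tau> j - s))"
    proof (rule continuous_on_compose2[of "{- \<tau> N..0}" \<phi>])
      show "continuous_on {- \<tau> N..0} \<phi>" using assms(5) by (simp add: compatible_initial_data_def)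
    qed (use \<tau>[OF j] in \<open>auto intro!: continuous_intros\<close>)
    moreover have "continuous_on {s..<s + \<tau> j} (D j)"
      using assms(4)[OF j] by (rule continuous_on_subset) simp
    ultimately show "continuous_on {s..<s + \<tau> j} (\<lambda>\<alpha>. D j \<alpha> *v \<phi> (\<alpha> - \<tau> j - s))"
      unfolding matrix_vector_mult_def by (intro continuous_intros)
  qed (use \<tau>[OF j] in auto)
  moreover have "y t = (\<Sum>j=1..N. \<Sum>p\<in>T \<inter> {s..<s + \<tau> j}. c p *v (D j p *v \<phi> (p - \<tau> j - s)))"
  proof -
    have "y t = (\<Sum>p\<in>T. \<Sum>j=1..N. c p *v (if p \<in> {s..<s + \<tau> j} then D j p *v \<phi> (p - \<tau> j - s) else 0))"
      using zt t by (simp add: z_def h_def matrix_vector_mult_sum_right)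
    also have "\<dots> = (\<Sum>j=1..N. \<Sum>p\<in>T. if p \<in> {s..<s + \<tau> j} then c p *v (D j p *v \<phi> (p - \<tau> j - s)) else 0)"
      by (subst sum.swap) (intro sum.cong, auto)
    finally show ?thesis by (simp only: sum.inter_restrict[OF T])
  qed
  ultimately show "y t = - (\<Sum>j=1..N. matrix_stieltjes_integral {s..<s + \<tau> j} (\<lambda>\<alpha>. X t \<alpha>)
           (\<lambda>\<alpha>. D j \<alpha> *v \<phi> (\<alpha> - \<tau> j - s)))"
    by (simp add: sum_negf)
qed

end
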